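(* Consider the linear model $y_k=\mathbf{x}_k^T\boldsymbol\beta+\varepsilon_k$, $k=1,2,\dots$, where $\boldsymbol\beta\in\mathbb{R}^p$ is an unknown parameter, $(\mathbf{x}_k)$ is a sequence of (deterministic) regression vectors in $\mathbb{R}^p$ and $(\varepsilon_k)$ is a strong white noise with variance $\sigma^2$. Let $(\lambda_n)$ be a sequence of non-negative numbers. For $t\ge 0$ let $\widehat{\boldsymbol\beta}_n(t)$ be a minimizer over $\boldsymbol\phi\in\mathbb{R}^p$ of $$\Lambda_n(\boldsymbol\phi,t)=\frac1n\sum_{k=1}^n(y_k-\mathbf{x}_k^T\boldsymbol\phi)^2+t\,\lambda_n\sum_{i=1}^p|\phi_i| .$$ Let $\mathbf{X}_n=[\mathbf{x}_1,\dots,\mathbf{x}_n]^T$ and assume that (i) $C_n=n^{-1}\mathbf{X}_n^T\mathbf{X}_n\to C$ as $n\to\infty$, where $C$ is a positive-definite matrix; (ii) $\lambda_n\to0$. Then $\widehat{\boldsymbol\beta}_n(t)$ converges in probability to $\boldsymbol\beta$ locally uniformly in $t\in\mathbb{R}_+$, that is, $\widehat{\boldsymbol\beta}_n\to\boldsymbol\beta$ in probability in $\ell^\infty_o(\mathbb{R}_+,\mathbb{R}^p)$.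
   Context: A strong white noise with variance $\sigma^2$ is a sequence of i.i.d. centered real random variables with variance $\sigma^2<\infty$. The dimension $p$ is fixed. $\mathbb{R}_+=[0,\infty)$, and $\ell^\infty_o(\mathbb{R}_+,\mathbb{R}^p)$ denotes the space of locally bounded functions $\mathbb{R}_+\to\mathbb{R}^p$, endowed with the topology of uniform convergence on every compact subset of $\mathbb{R}_+$; here $\boldsymbol\beta$ is identified with the constant function $t\mapsto\boldsymbol\beta$. Thus the conclusion means that for every compact $T\subset\mathbb{R}_+$, $\sup_{t\in T}\|\widehat{\boldsymbol\beta}_n(t)-\boldsymbol\beta\|\to0$ in probability. *)

theory Defs
  imports "HOL-Probability.Probability"
begin

text \<open>Observations, regressors and noise are sequences indexed by \<open>nat\<close>, of which only the
  indices \<open>k \<ge> 1\<close> are used.\<close>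

definition strong_white_noise :: "'a measure \<Rightarrow> (nat \<Rightarrow> 'a \<Rightarrow> real) \<Rightarrow> real \<Rightarrow> bool" where
  "strong_white_noise M \<epsilon> \<sigma> \<longleftrightarrow>
     prob_space.indep_vars M (\<lambda>_. borel) \<epsilon> {1..} \<and>
     (\<forall>k\<ge>1. distr M borel (\<epsilon> k) = distr M borel (\<epsilon> 1)) \<and>
     (\<forall>k\<ge>1. integrable M (\<epsilon> k) \<and> prob_space.expectation M (\<epsilon> k) = 0) \<and>
     (\<forall>k\<ge>1. integrable M (\<lambda>\<omega>. (\<epsilon> k \<omega>)\<^sup>2) \<and> prob_space.variance M (\<epsilon> k) = \<sigma>\<^sup>2)"

text \<open>The entries of the \<open>p \<times> p\<close> matrix \<open>n\<^sup>-\<^sup>1 X\<^sub>n\<^sup>T X\<^sub>n\<close>. The matrix \<open>X\<^sub>n\<close>, with rows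
  \<open>x 1, \<dots>, x n\<close>, has a varying number of rows and so is not itself a value of type
  \<open>real ^ 'p ^ 'n\<close>; the matrix product is written out as a sum over the rows.\<close>

definition scaled_gram :: "(nat \<Rightarrow> real ^ 'p) \<Rightarrow> nat \<Rightarrow> real ^ 'p ^ 'p" where
  "scaled_gram x n = (\<chi> i j. (\<Sum>k=1..n. x k $ i * x k $ j) / real n)"

definition positive_definite :: "real ^ 'p ^ 'p \<Rightarrow> bool" where
  "positive_definite A \<longleftrightarrow> transpose A = A \<and> (\<forall>v. v \<noteq> 0 \<longrightarrow> v \<bullet> (A *v v) > 0)"

definition lasso_objective ::
  "(nat \<Rightarrow> real ^ 'p) \<Rightarrow> (nat \<Rightarrow> real) \<Rightarrow> (nat \<Rightarrow> real) \<Rightarrow> nat \<Rightarrow> real ^ 'p \<Rightarrow> real \<Rightarrow> real" where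
  "lasso_objective x y lam n \<phi> t =
     (\<Sum>k=1..n. (y k - x k \<bullet> \<phi>)\<^sup>2) / real n + t * lam n * (\<Sum>i\<in>UNIV. \<bar>\<phi> $ i\<bar>)"

text \<open>Convergence in probability for the topology of uniform convergence on the compact subsets
  of \<open>{0..}\<close>. The processes are not required to be measurable, so outer probability is used: for a
  measurable event it coincides with the probability, whereas \<^const>\<open>measure\<close> and
  \<^const>\<open>emeasure\<close> would vanish on a non-measurable set. The supremum is taken in
  \<^typ>\<open>ennreal\<close>, so that it is meaningful for every sample path (infinite if the path is unbounded
  on \<open>T\<close>, and zero for empty \<open>T\<close>).\<close>

definition tendsto_in_prob_locally_uniformly ::
  "'a measure \<Rightarrow> (nat \<Rightarrow> real \<Rightarrow> 'a \<Rightarrow> 'b::metric_space) \<Rightarrow> (real \<Rightarrow> 'b) \<Rightarrow> bool" where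
  "tendsto_in_prob_locally_uniformly M Z z \<longleftrightarrow>
     (\<forall>T. compact T \<and> T \<subseteq> {0..} \<longrightarrow>
       (\<forall>e>0. (\<lambda>n. outer_measure_of M
                 {\<omega> \<in> space M. (SUP t\<in>T. ennreal (dist (Z n t \<omega>) (z t))) > ennreal e})
              \<longlonglongrightarrow> 0))"

end

theory Submission
  imports Defs
begin

text \<open>
  Write \<open>u = \<beta>hat n t - \<beta>\<close> for the estimation error and \<open>w = n\<^sup>-\<^sup>1 \<Sum>\<^sub>k \<epsilon>\<^sub>k x\<^sub>k\<close> for the normalised
  score. Comparing the objective at its minimizer with its value at the true parameter \<open>\<beta>\<close>, and
  bounding the difference of the two penalties by the triangle inequality, gives
  \<open>u \<bullet> C\<^sub>n u \<le> 2 (u \<bullet> w) + t \<lambda>\<^sub>n \<Sum>\<^sub>i \<bar>u\<^sub>i\<bar>\<close> (\<open>lasso_basic_inequality\<close>). Since \<open>C\<^sub>n\<close> converges to a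
  positive-definite matrix, its quadratic form is eventually bounded below by \<open>c \<parallel>u\<parallel>\<^sup>2\<close> with one
  constant \<open>c > 0\<close> (\<open>eventually_coercive\<close>), and cancelling one factor \<open>\<parallel>u\<parallel>\<close> leaves
  \<open>c \<parallel>u\<parallel> \<le> 2 \<parallel>w\<parallel> + t \<lambda>\<^sub>n p\<close> (\<open>lasso_error_bound\<close>).

  This is a pathwise bound whose random part does not depend on \<open>t\<close>. Hence it holds
  simultaneously for all \<open>t\<close> in a compact set, where \<open>t \<lambda>\<^sub>n \<longlonglongrightarrow> 0\<close> uniformly, and for large \<open>n\<close>
  the event of a large supremum is contained in the measurable event that \<open>\<parallel>w\<parallel>\<close> is large. This
  controls the outer probability of the former by the probability of the latter, which vanishes by
  Markov's inequality, since orthogonality of the noise gives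
  \<open>E \<parallel>w\<parallel>\<^sup>2 = \<sigma>\<^sup>2 trace C\<^sub>n / n\<close> (\<open>expectation_score_norm_square\<close>).
\<close>

section \<open>The scaled Gram matrix\<close>

lemma inner_scaled_gram:
  "v \<bullet> (scaled_gram x n *v v) = (\<Sum>k=1..n. (x k \<bullet> v)\<^sup>2) / real n"
proof -
  have "v \<bullet> (scaled_gram x n *v v)
      = (\<Sum>i\<in>UNIV. \<Sum>j\<in>UNIV. \<Sum>k=1..n. (x k $ i * v $ i) * (x k $ j * v $ j)) / real n"
    by (simp add: scaled_gram_def matrix_vector_mult_def inner_vec_def sum_distrib_left
        sum_distrib_right sum_divide_distrib mult_ac)
  also have "(\<Sum>i\<in>UNIV. \<Sum>j\<in>UNIV. \<Sum>k=1..n. (x k $ i * v $ i) * (x k $ j * v $ j))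
      = (\<Sum>k=1..n. \<Sum>i\<in>UNIV. \<Sum>j\<in>UNIV. (x k $ i * v $ i) * (x k $ j * v $ j))"
    by (simp only: sum.swap[where A = UNIV and B = "{1..n}"])
  also have "\<dots> = (\<Sum>k=1..n. (x k \<bullet> v)\<^sup>2)"
    by (simp add: inner_vec_def power2_eq_square sum_product)
  finally show ?thesis .
qed

lemma trace_scaled_gram: "trace (scaled_gram x n) = (\<Sum>k=1..n. (norm (x k))\<^sup>2) / real n"
  unfolding trace_def scaled_gram_def
  by (simp add: power2_norm_eq_inner inner_vec_def sum_divide_distrib)
     (rule sum.swap)

text \<open>The constant is the minimum of the quadratic form on the unit sphere; homogeneity extends the
  bound from the sphere to the whole space.\<close>

lemma positive_definite_coercive:
  fixes C :: "real ^ 'p ^ 'p"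
  assumes "positive_definite C"
  obtains c where "c > 0" "\<And>v. v \<bullet> (C *v v) \<ge> c * (norm v)\<^sup>2"
proof -
  let ?q = "\<lambda>v. v \<bullet> (C *v v)"
  have "continuous_on (sphere 0 1) ?q"
    by (intro continuous_intros linear_continuous_on matrix_vector_mul_bounded_linear)
  moreover have "sphere (0 :: real ^ 'p) 1 \<noteq> {}"
    using norm_axis_1 by (metis dist_0_norm empty_iff mem_sphere)
  ultimately have "\<exists>v0\<in>sphere 0 1. \<forall>v\<in>sphere 0 1. ?q v0 \<le> ?q v"
    by (intro continuous_attains_inf compact_sphere)
  then obtain v0 where v0: "v0 \<in> sphere 0 1" and min: "\<And>v. v \<in> sphere 0 1 \<Longrightarrow> ?q v0 \<le> ?q v"
    by blast
  have "v0 \<noteq> 0" using v0 by auto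
  then have "?q v0 > 0" using assms by (simp add: positive_definite_def)
  moreover have "?q v0 * (norm v)\<^sup>2 \<le> ?q v" for v
  proof (cases "v = 0")
    case False
    let ?s = "v /\<^sub>R norm v"
    have *: "?q v = (norm v)\<^sup>2 * ?q ?s"
      using False by (simp add: matrix_vector_mult_scaleR power2_eq_square field_simps)
    have "?q v0 \<le> ?q ?s" by (rule min) (use False in simp)
    then have "(norm v)\<^sup>2 * ?q v0 \<le> (norm v)\<^sup>2 * ?q ?s" by (rule mult_left_mono) simp
    with * show ?thesis by (metis mult.commute)
  qed simp
  ultimately show thesis by (rule that)
qed

text \<open>Coercivity is an open condition on the matrix: if the operator norm of \<open>A n - C\<close> is at most
  half of a coercivity constant of \<open>C\<close>, then the other half is one for \<open>A n\<close>.\<close>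

lemma eventually_coercive:
  fixes C :: "real ^ 'p ^ 'p"
  assumes lim: "A \<longlonglongrightarrow> C" and "positive_definite C"
  obtains c where "c > 0" "eventually (\<lambda>n. \<forall>v. v \<bullet> (A n *v v) \<ge> c * (norm v)\<^sup>2) sequentially"
proof -
  obtain c where c: "c > 0" "\<And>v. v \<bullet> (C *v v) \<ge> c * (norm v)\<^sup>2"
    using positive_definite_coercive assms(2) by blast
  let ?d = "\<lambda>n. \<Sum>i\<in>UNIV. \<Sum>j\<in>UNIV. \<bar>(A n - C) $ i $ j\<bar>"
  have "?d \<longlonglongrightarrow> (\<Sum>i\<in>UNIV. \<Sum>j\<in>UNIV. \<bar>(C - C) $ i $ j\<bar>)"
    by (intro tendsto_intros lim)
  then have "eventually (\<lambda>n. ?d n < c / 2) sequentially"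
    using c(1) by (intro order_tendstoD(2)) auto
  then have "eventually (\<lambda>n. \<forall>v. v \<bullet> (A n *v v) \<ge> c / 2 * (norm v)\<^sup>2) sequentially"
  proof eventually_elim
    case (elim n)
    show ?case
    proof
      fix v
      have "norm ((A n - C) *v v) \<le> onorm ((*v) (A n - C)) * norm v"
        by (rule onorm) (rule matrix_vector_mul_bounded_linear)
      also have "\<dots> \<le> c / 2 * norm v"
        using onorm_le_matrix_component_sum[of "A n - C"] elim by (intro mult_right_mono) auto
      finally have "norm v * norm ((A n - C) *v v) \<le> norm v * (c / 2 * norm v)"
        by (rule mult_left_mono) simp
      with Cauchy_Schwarz_ineq2[of v "(A n - C) *v v"]
      have "\<bar>v \<bullet> ((A n - C) *v v)\<bar> \<le> norm v * (c / 2 * norm v)" by linarith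
      then have "\<bar>v \<bullet> ((A n - C) *v v)\<bar> \<le> c / 2 * (norm v)\<^sup>2"
        by (simp add: power2_eq_square mult_ac)
      then show "v \<bullet> (A n *v v) \<ge> c / 2 * (norm v)\<^sup>2"
        using c(2)[of v] unfolding matrix_vector_mult_diff_rdistrib inner_diff_right by linarith
    qed
  qed
  then show thesis using c(1) by (intro that[of "c / 2"]) auto
qed

section \<open>The pathwise error bound\<close>

definition score :: "(nat \<Rightarrow> 'b::real_vector) \<Rightarrow> (nat \<Rightarrow> real) \<Rightarrow> nat \<Rightarrow> 'b" where
  "score x e n = (\<Sum>k=1..n. e k *\<^sub>R x k) /\<^sub>R real n"

text \<open>The residual at \<open>\<phi>\<close> is \<open>e k - x k \<bullet> (\<phi> - \<beta>)\<close>, so expanding the squares produces the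
  quadratic form of the Gram matrix, a linear term given by the score, and the noise energy,
  which cancels against the objective at \<open>\<beta>\<close>.\<close>

lemma lasso_basic_inequality:
  assumes y: "\<And>k. k \<in> {1..n} \<Longrightarrow> y k = x k \<bullet> \<beta> + e k"
    and nonneg: "t * lam n \<ge> 0"
    and le: "lasso_objective x y lam n \<phi> t \<le> lasso_objective x y lam n \<beta> t"
  shows "(\<phi> - \<beta>) \<bullet> (scaled_gram x n *v (\<phi> - \<beta>))
      \<le> 2 * ((\<phi> - \<beta>) \<bullet> score x e n) + t * lam n * (\<Sum>i\<in>UNIV. \<bar>(\<phi> - \<beta>) $ i\<bar>)"
proof -
  let ?u = "\<phi> - \<beta>"
  have "(\<Sum>k=1..n. (y k - x k \<bullet> \<phi>)\<^sup>2)
      = (\<Sum>k=1..n. (e k)\<^sup>2 - 2 * (e k * (x k \<bullet> ?u)) + (x k \<bullet> ?u)\<^sup>2)"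
    by (intro sum.cong) (auto simp: y power2_eq_square algebra_simps)
  also have "\<dots> = (\<Sum>k=1..n. (e k)\<^sup>2) - 2 * (\<Sum>k=1..n. e k * (x k \<bullet> ?u)) + (\<Sum>k=1..n. (x k \<bullet> ?u)\<^sup>2)"
    by (simp add: sum.distrib sum_subtractf sum_distrib_left)
  finally have 1: "(\<Sum>k=1..n. (y k - x k \<bullet> \<phi>)\<^sup>2) / real n = (\<Sum>k=1..n. (e k)\<^sup>2) / real n
      - 2 * (?u \<bullet> score x e n) + ?u \<bullet> (scaled_gram x n *v ?u)"
    by (simp add: inner_scaled_gram score_def inner_sum_right add_divide_distrib diff_divide_distrib
        inner_commute[of ?u] divide_inverse_commute[symmetric])
  have 2: "(\<Sum>k=1..n. (y k - x k \<bullet> \<beta>)\<^sup>2) = (\<Sum>k=1..n. (e k)\<^sup>2)"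
    by (intro sum.cong) (auto simp: y)
  have "(\<Sum>i\<in>UNIV. \<bar>\<beta> $ i\<bar>) - (\<Sum>i\<in>UNIV. \<bar>\<phi> $ i\<bar>) \<le> (\<Sum>i\<in>UNIV. \<bar>?u $ i\<bar>)"
    unfolding sum_subtractf[symmetric] by (intro sum_mono) auto
  then have "t * lam n * (\<Sum>i\<in>UNIV. \<bar>\<beta> $ i\<bar>) - t * lam n * (\<Sum>i\<in>UNIV. \<bar>\<phi> $ i\<bar>)
      \<le> t * lam n * (\<Sum>i\<in>UNIV. \<bar>?u $ i\<bar>)"
    using nonneg by (simp add: mult_left_mono flip: right_diff_distrib)
  then show ?thesis using le unfolding lasso_objective_def 1 2 by linarith
qed

lemma lasso_error_bound:
  fixes x :: "nat \<Rightarrow> real ^ 'p"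
  assumes y: "\<And>k. k \<in> {1..n} \<Longrightarrow> y k = x k \<bullet> \<beta> + e k"
    and nonneg: "t * lam n \<ge> 0"
    and le: "lasso_objective x y lam n \<phi> t \<le> lasso_objective x y lam n \<beta> t"
    and coercive: "\<And>v. v \<bullet> (scaled_gram x n *v v) \<ge> c * (norm v)\<^sup>2"
  shows "c * norm (\<phi> - \<beta>) \<le> 2 * norm (score x e n) + t * lam n * real CARD('p)"
proof (cases "\<phi> = \<beta>")
  case True
  then show ?thesis using nonneg by simp
next
  case False
  let ?u = "\<phi> - \<beta>"
  have "(\<Sum>i\<in>UNIV. \<bar>?u $ i\<bar>) \<le> real CARD('p) * norm ?u"
    using sum_bounded_above[of UNIV "\<lambda>i. \<bar>?u $ i\<bar>" "norm ?u"] component_le_norm_cart[of ?u] by simp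
  then have "t * lam n * (\<Sum>i\<in>UNIV. \<bar>?u $ i\<bar>) \<le> t * lam n * (real CARD('p) * norm ?u)"
    using nonneg by (rule mult_left_mono)
  moreover have "?u \<bullet> score x e n \<le> norm ?u * norm (score x e n)"
    by (rule norm_cauchy_schwarz)
  ultimately have "c * (norm ?u)\<^sup>2
      \<le> 2 * (norm ?u * norm (score x e n)) + t * lam n * (real CARD('p) * norm ?u)"
    using coercive[of ?u] lasso_basic_inequality[OF y nonneg le] by linarith
  then have "(c * norm ?u) * norm ?u \<le> (2 * norm (score x e n) + t * lam n * real CARD('p)) * norm ?u"
    by (simp add: power2_eq_square algebra_simps)
  then show ?thesis
    by (rule mult_right_le_imp_le) (use False in simp)
qed

section \<open>The score of a strong white noise\<close>

lemma strong_white_noise_orthogonal: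
  assumes "prob_space M" and noise: "strong_white_noise M \<epsilon> \<sigma>" and "j \<ge> 1" "k \<ge> 1"
  shows "integrable M (\<lambda>\<omega>. \<epsilon> j \<omega> * \<epsilon> k \<omega>)"
    and "(\<integral>\<omega>. \<epsilon> j \<omega> * \<epsilon> k \<omega> \<partial>M) = (if j = k then \<sigma>\<^sup>2 else 0)"
proof -
  interpret prob_space M by fact
  have int: "integrable M (\<epsilon> i)" "expectation (\<epsilon> i) = 0" if "i \<ge> 1" for i
    using noise that by (auto simp: strong_white_noise_def)
  have "integrable M (\<lambda>\<omega>. \<epsilon> j \<omega> * \<epsilon> k \<omega>) \<and>
      (\<integral>\<omega>. \<epsilon> j \<omega> * \<epsilon> k \<omega> \<partial>M) = (if j = k then \<sigma>\<^sup>2 else 0)"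
  proof (cases "j = k")
    case True
    have "integrable M (\<lambda>\<omega>. (\<epsilon> k \<omega>)\<^sup>2)" "variance (\<epsilon> k) = \<sigma>\<^sup>2"
      using noise \<open>k \<ge> 1\<close> by (auto simp: strong_white_noise_def)
    then show ?thesis using True int(2)[OF \<open>k \<ge> 1\<close>] by (simp add: power2_eq_square)
  next
    case False
    have "indep_vars (\<lambda>_. borel) \<epsilon> {1..}"
      using noise by (simp add: strong_white_noise_def)
    then have "indep_vars (\<lambda>_. borel) \<epsilon> (insert j {k})"
      by (rule indep_vars_subset) (use assms(3,4) in auto)
    then have "indep_var borel (\<epsilon> j) borel (\<epsilon> k)"
      using indep_vars_sum[of "{k}" j \<epsilon>] False by simp
    then show ?thesis
      using indep_var_lebesgue_integral[of "\<epsilon> j" "\<epsilon> k"] indep_var_integrable[of "\<epsilon> j" "\<epsilon> k"]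
        int assms(3,4) False by simp
  qed
  then show "integrable M (\<lambda>\<omega>. \<epsilon> j \<omega> * \<epsilon> k \<omega>)"
    and "(\<integral>\<omega>. \<epsilon> j \<omega> * \<epsilon> k \<omega> \<partial>M) = (if j = k then \<sigma>\<^sup>2 else 0)" by auto
qed

text \<open>Expanding the square of the norm, orthogonality kills the off-diagonal terms, and the
  remaining sum of squared regressor norms is the trace of the Gram matrix.\<close>

lemma expectation_score_norm_square:
  fixes x :: "nat \<Rightarrow> real ^ 'p"
  assumes prob: "prob_space M" and noise: "strong_white_noise M \<epsilon> \<sigma>"
  shows "integrable M (\<lambda>\<omega>. (norm (score x (\<lambda>k. \<epsilon> k \<omega>) n))\<^sup>2)"
    and "(\<integral>\<omega>. (norm (score x (\<lambda>k. \<epsilon> k \<omega>) n))\<^sup>2 \<partial>M) = \<sigma>\<^sup>2 * trace (scaled_gram x n) / real n"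
proof -
  note orth = strong_white_noise_orthogonal[OF prob noise]
  have expand: "(norm (score x (\<lambda>k. \<epsilon> k \<omega>) n))\<^sup>2
      = (\<Sum>j=1..n. \<Sum>k=1..n. (\<epsilon> j \<omega> * \<epsilon> k \<omega>) * (x j \<bullet> x k)) / (real n)\<^sup>2" for \<omega>
    unfolding score_def power2_norm_eq_inner
    by (simp add: inner_sum_left inner_sum_right power2_eq_square
        sum_distrib_left sum_divide_distrib divide_inverse mult_ac inner_commute)
  show "integrable M (\<lambda>\<omega>. (norm (score x (\<lambda>k. \<epsilon> k \<omega>) n))\<^sup>2)"
    unfolding expand
    by (intro integrable_divide_zero Bochner_Integration.integrable_sum integrable_mult_left impI orth)
       auto
  have int: "integrable M (\<lambda>\<omega>. (\<epsilon> j \<omega> * \<epsilon> k \<omega>) * (x j \<bullet> x k))"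
    if "j \<in> {1..n}" "k \<in> {1..n}" for j k
    using that by (intro integrable_mult_left orth) auto
  have "(\<integral>\<omega>. (norm (score x (\<lambda>k. \<epsilon> k \<omega>) n))\<^sup>2 \<partial>M)
      = (\<Sum>j=1..n. \<integral>\<omega>. (\<Sum>k=1..n. (\<epsilon> j \<omega> * \<epsilon> k \<omega>) * (x j \<bullet> x k)) \<partial>M) / (real n)\<^sup>2"
    unfolding expand integral_divide_zero
    by (subst Bochner_Integration.integral_sum) (rule refl | intro Bochner_Integration.integrable_sum int; assumption)+
  also have "\<dots> = (\<Sum>j=1..n. \<Sum>k=1..n. (\<integral>\<omega>. \<epsilon> j \<omega> * \<epsilon> k \<omega> \<partial>M) * (x j \<bullet> x k)) / (real n)\<^sup>2"
    using int by (intro arg_cong2[where f="(/)"] sum.cong refl)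
      (simp add: Bochner_Integration.integral_sum del: integral_mult_left_zero, simp)
  also have "\<dots> = (\<Sum>j=1..n. \<Sum>k=1..n. if j = k then \<sigma>\<^sup>2 * (x j \<bullet> x k) else 0) / (real n)\<^sup>2"
    by (intro arg_cong2[where f="(/)"] sum.cong refl) (auto simp: orth)
  also have "\<dots> = \<sigma>\<^sup>2 * trace (scaled_gram x n) / real n"
    by (simp add: trace_scaled_gram power2_norm_eq_inner sum_distrib_left power2_eq_square[of "real n"])
  finally show "(\<integral>\<omega>. (norm (score x (\<lambda>k. \<epsilon> k \<omega>) n))\<^sup>2 \<partial>M) = \<sigma>\<^sup>2 * trace (scaled_gram x n) / real n" .
qed

lemma emeasure_score_ge:
  fixes x :: "nat \<Rightarrow> real ^ 'p"
  assumes prob: "prob_space M" and noise: "strong_white_noise M \<epsilon> \<sigma>" and "\<delta> > 0"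
  shows "{\<omega> \<in> space M. norm (score x (\<lambda>k. \<epsilon> k \<omega>) n) \<ge> \<delta>} \<in> sets M"
    and "emeasure M {\<omega> \<in> space M. norm (score x (\<lambda>k. \<epsilon> k \<omega>) n) \<ge> \<delta>}
      \<le> ennreal (\<sigma>\<^sup>2 * trace (scaled_gram x n) / real n / \<delta>\<^sup>2)"
proof -
  note int = expectation_score_norm_square[OF prob noise, of x n]
  have eq: "{\<omega> \<in> space M. norm (score x (\<lambda>k. \<epsilon> k \<omega>) n) \<ge> \<delta>}
      = {\<omega> \<in> space M. (norm (score x (\<lambda>k. \<epsilon> k \<omega>) n))\<^sup>2 \<ge> \<delta>\<^sup>2}"
    using \<open>\<delta> > 0\<close> by (auto simp: abs_le_square_iff[symmetric])
  have [measurable]: "(\<lambda>\<omega>. (norm (score x (\<lambda>k. \<epsilon> k \<omega>) n))\<^sup>2) \<in> borel_measurable M"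
    using int(1) by simp
  show "{\<omega> \<in> space M. norm (score x (\<lambda>k. \<epsilon> k \<omega>) n) \<ge> \<delta>} \<in> sets M"
    unfolding eq by measurable
  show "emeasure M {\<omega> \<in> space M. norm (score x (\<lambda>k. \<epsilon> k \<omega>) n) \<ge> \<delta>}
      \<le> ennreal (\<sigma>\<^sup>2 * trace (scaled_gram x n) / real n / \<delta>\<^sup>2)"
    using integral_Markov_inequality[OF int(1), of "\<delta>\<^sup>2"] \<open>\<delta> > 0\<close>
    unfolding eq int(2) by (simp add: mult_ac)
qed

section \<open>Consistency\<close>

theorem theorem1:
  fixes M :: "'a measure"
    and \<beta> :: "real ^ 'p"
    and x :: "nat \<Rightarrow> real ^ 'p"
    and \<epsilon> y :: "nat \<Rightarrow> 'a \<Rightarrow> real"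
    and \<sigma> :: real
    and lam :: "nat \<Rightarrow> real"
    and \<beta>hat :: "nat \<Rightarrow> real \<Rightarrow> 'a \<Rightarrow> real ^ 'p"
    and C :: "real ^ 'p ^ 'p"
  assumes prob: "prob_space M"
    and noise: "strong_white_noise M \<epsilon> \<sigma>"
    and model: "\<And>k \<omega>. k \<ge> 1 \<Longrightarrow> \<omega> \<in> space M \<Longrightarrow> y k \<omega> = x k \<bullet> \<beta> + \<epsilon> k \<omega>"
    and lambda_nonneg: "\<And>n. n \<ge> 1 \<Longrightarrow> lam n \<ge> 0"
    and minimizer: "\<And>n t \<omega>. n \<ge> 1 \<Longrightarrow> t \<ge> 0 \<Longrightarrow> \<omega> \<in> space M \<Longrightarrow>
      is_arg_min (\<lambda>\<phi>. lasso_objective x (\<lambda>k. y k \<omega>) lam n \<phi> t) (\<lambda>_. True) (\<beta>hat n t \<omega>)"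
    and gram_tendsto: "scaled_gram x \<longlonglongrightarrow> C"
    and pos_def: "positive_definite C"
    and lambda_tendsto: "lam \<longlonglongrightarrow> 0"
  shows "tendsto_in_prob_locally_uniformly M \<beta>hat (\<lambda>t. \<beta>)"
  unfolding tendsto_in_prob_locally_uniformly_def
proof (intro allI impI)
  fix T :: "real set" and e :: real
  assume T: "compact T \<and> T \<subseteq> {0..}" and "e > 0"
  obtain c where c: "c > 0"
    and coercive: "eventually (\<lambda>n. \<forall>v. v \<bullet> (scaled_gram x n *v v) \<ge> c * (norm v)\<^sup>2) sequentially"
    using eventually_coercive[OF gram_tendsto pos_def] by blast
  obtain B where B: "\<And>t. t \<in> T \<Longrightarrow> t \<le> B"
    using T compact_imp_bounded bounded_has_Sup(1) by (metis empty_iff)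
  \<comment> \<open>Half of the budget \<open>c * e\<close> goes to the score term \<open>2 * \<delta>\<close>, the other half to the penalty.\<close>
  define \<delta> where "\<delta> = c * e / 4"
  have "\<delta> > 0" using c \<open>e > 0\<close> by (simp add: \<delta>_def)
  let ?p = "real CARD('p)"
  let ?bad = "\<lambda>n. {\<omega> \<in> space M. (SUP t\<in>T. ennreal (dist (\<beta>hat n t \<omega>) \<beta>)) > ennreal e}"
  let ?large = "\<lambda>n. {\<omega> \<in> space M. norm (score x (\<lambda>k. \<epsilon> k \<omega>) n) \<ge> \<delta>}"
  let ?bound = "\<lambda>n. \<sigma>\<^sup>2 * trace (scaled_gram x n) / real n / \<delta>\<^sup>2"
  have "(\<lambda>n. B * lam n * ?p) \<longlonglongrightarrow> B * 0 * ?p"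
    by (intro tendsto_intros lambda_tendsto)
  then have penalty: "eventually (\<lambda>n. B * lam n * ?p < c * e / 2) sequentially"
    by (rule order_tendstoD(2)) (use c \<open>e > 0\<close> in simp)
  have "eventually (\<lambda>n. outer_measure_of M (?bad n) \<le> ennreal (?bound n)) sequentially"
    using coercive penalty eventually_ge_at_top[of 1]
  proof eventually_elim
    case (elim n)
    have "?bad n \<subseteq> ?large n"
    proof
      fix \<omega> assume bad: "\<omega> \<in> ?bad n"
      then have \<omega>: "\<omega> \<in> space M" by simp
      show "\<omega> \<in> ?large n"
      proof (rule ccontr)
        assume "\<omega> \<notin> ?large n"
        then have small: "norm (score x (\<lambda>k. \<epsilon> k \<omega>) n) < \<delta>" using \<omega> by simp
        have "dist (\<beta>hat n t \<omega>) \<beta> \<le> e" if "t \<in> T" for t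
        proof -
          have t: "0 \<le> t" "t \<le> B" using that T B by auto
          have lam: "lam n \<ge> 0" using lambda_nonneg elim(3) by simp
          have "lasso_objective x (\<lambda>k. y k \<omega>) lam n (\<beta>hat n t \<omega>) t
              \<le> lasso_objective x (\<lambda>k. y k \<omega>) lam n \<beta> t"
            using minimizer[OF elim(3) t(1) \<omega>] by (auto simp: is_arg_min_linorder)
          then have "c * norm (\<beta>hat n t \<omega> - \<beta>)
              \<le> 2 * norm (score x (\<lambda>k. \<epsilon> k \<omega>) n) + t * lam n * ?p"
            using t lam elim(1) model \<omega> by (intro lasso_error_bound[where y="\<lambda>k. y k \<omega>"]) auto
          also have "\<dots> \<le> 2 * norm (score x (\<lambda>k. \<epsilon> k \<omega>) n) + B * lam n * ?p"
            using t lam by (intro add_left_mono mult_right_mono) auto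
          also have "\<dots> \<le> c * e"
            using small elim(2) by (simp add: \<delta>_def)
          finally show ?thesis using c by (simp add: dist_norm)
        qed
        then have "(SUP t\<in>T. ennreal (dist (\<beta>hat n t \<omega>) \<beta>)) \<le> ennreal e"
          by (intro SUP_least ennreal_leI)
        then show False using bad by (simp add: not_less[symmetric])
      qed
    qed
    then have "outer_measure_of M (?bad n) \<le> outer_measure_of M (?large n)"
      by (rule outer_measure_of_mono)
    also have "\<dots> \<le> ennreal (?bound n)"
      using emeasure_score_ge[OF prob noise \<open>\<delta> > 0\<close>, of x n] by simp
    finally show ?case .
  qed
  moreover have "(\<lambda>n. ennreal (?bound n)) \<longlonglongrightarrow> 0"
  proof -
    have "(\<lambda>n. trace (scaled_gram x n)) \<longlonglongrightarrow> trace C"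
      unfolding trace_def by (intro tendsto_intros gram_tendsto)
    then have "(\<lambda>n. \<sigma>\<^sup>2 * trace (scaled_gram x n) * (1 / real n) / \<delta>\<^sup>2) \<longlonglongrightarrow> \<sigma>\<^sup>2 * trace C * 0 / \<delta>\<^sup>2"
      using \<open>\<delta> > 0\<close> by (intro tendsto_intros lim_1_over_n) auto
    then show ?thesis using tendsto_ennrealI by fastforce
  qed
  ultimately show "(\<lambda>n. outer_measure_of M (?bad n)) \<longlonglongrightarrow> 0"
    by (rule tendsto_sandwich[OF always_eventually[OF allI[OF zero_le]] _ tendsto_const])
qed

end
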